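(* Let $(X,d,\mu)$ be a coarse median space. Then $X$ has rank at most $1$ if and only if there exists a constant $\lambda$ such that for all $a,b,x\in X$ with $x\in[a,b]$, $$[a,b]\subseteq\mathcal N_\lambda([a,x])\cup\mathcal N_\lambda([x,b]).$$
   Context: Write $x\sim_s y$ if $d(x,y)\leqslant s$. A coarse median space is a triple $(X,d,\mu)$ with $(X,d)$ a metric space and $\mu\colon X^3\to X$ satisfying: (M1) $\mu(a,a,b)=a$; (M2) $\mu(a_1,a_2,a_3)$ is invariant under permutations of its arguments; (C1) there is an affine $\rho(t)=Kt+H_0$ with $d(\mu(a,b,c),\mu(a',b',c'))\leqslant\rho(d(a,a')+d(b,b')+d(c,c'))$ for all points; (C2) there is $H\colon\mathbb N\to[0,\infty)$ such that for every finite $A\subseteq X$ with $1\leqslant|A|\leqslant p$ there are a finite median algebra $(\Pi,\mu_\Pi)$ and maps $\pi\colon A\to\Pi$, $\lambda\colon\Pi\to X$ with $\lambda\mu_\Pi(x,y,z)\sim_{H(p)}\mu(\lambda x,\lambda y,\lambda z)$ for all $x,y,z\in\Pi$ and $\lambda\pi a\sim_{H(p)}a$ for all $a\in A$. (A median algebra is a set with a ternary operation $m$ satisfying $m(a,a,b)=a$, full symmetry, and $m(m(a,b,c),b,d)=m(a,b,m(c,b,d))$.) The rank of a median algebra is the supremum of $n$ such that it contains a subalgebra isomorphic to $I^n=(\mathbb Z_2)^n$ with coordinatewise majority vote as median. The coarse median space has rank at most $n$ if there exist $\rho,H$ as in (C1),(C2) for which $\Pi$ in (C2) can always be chosen of rank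 at most $n$. The interval is $[a,b]=\{\mu(a,y,b):y\in X\}$, and for $S\subseteq X$, $\mathcal N_\lambda(S)=\{y\in X:\exists s\in S,\ d(y,s)\leqslant\lambda\}$. *)

theory Defs
  imports Complex_Main
begin

definition median_algebra :: "'b set \<Rightarrow> ('b \<Rightarrow> 'b \<Rightarrow> 'b \<Rightarrow> 'b) \<Rightarrow> bool" where
  "median_algebra P m \<longleftrightarrow>
     (\<forall>a\<in>P. \<forall>b\<in>P. \<forall>c\<in>P. m a b c \<in> P) \<and>
     (\<forall>a\<in>P. \<forall>b\<in>P. m a a b = a) \<and>
     (\<forall>a\<in>P. \<forall>b\<in>P. \<forall>c\<in>P.
        m a b c = m b a c \<and> m a b c = m a c b \<and> m a b c = m c b a \<and>
        m a b c = m b c a \<and> m a b c = m c a b) \<and>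
     (\<forall>a\<in>P. \<forall>b\<in>P. \<forall>c\<in>P. \<forall>d\<in>P. m (m a b c) b d = m a b (m c b d))"

definition cube :: "nat \<Rightarrow> (nat \<Rightarrow> bool) set" where
  "cube k = {f. \<forall>i\<ge>k. f i = False}"

definition majority :: "(nat \<Rightarrow> bool) \<Rightarrow> (nat \<Rightarrow> bool) \<Rightarrow> (nat \<Rightarrow> bool) \<Rightarrow> (nat \<Rightarrow> bool)" where
  "majority f g h = (\<lambda>i. (f i \<and> g i) \<or> (g i \<and> h i) \<or> (f i \<and> h i))"

text \<open>P contains a subalgebra isomorphic to I^k: an injective median homomorphism I^k \<rightarrow> P
  (its image is then a subalgebra isomorphic to I^k).\<close>

definition contains_cube :: "'b set \<Rightarrow> ('b \<Rightarrow> 'b \<Rightarrow> 'b \<Rightarrow> 'b) \<Rightarrow> nat \<Rightarrow> bool" where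
  "contains_cube P m k \<longleftrightarrow>
     (\<exists>\<phi>. inj_on \<phi> (cube k) \<and> \<phi> ` cube k \<subseteq> P \<and>
        (\<forall>x\<in>cube k. \<forall>y\<in>cube k. \<forall>z\<in>cube k. \<phi> (majority x y z) = m (\<phi> x) (\<phi> y) (\<phi> z)))"

definition median_rank_le :: "'b set \<Rightarrow> ('b \<Rightarrow> 'b \<Rightarrow> 'b \<Rightarrow> 'b) \<Rightarrow> nat \<Rightarrow> bool" where
  "median_rank_le P m n \<longleftrightarrow> (\<forall>k. contains_cube P m k \<longrightarrow> k \<le> n)"

definition cm_M1 :: "('a \<Rightarrow> 'a \<Rightarrow> 'a \<Rightarrow> 'a) \<Rightarrow> bool" where
  "cm_M1 mu \<longleftrightarrow> (\<forall>a b. mu a a b = a)"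

definition cm_M2 :: "('a \<Rightarrow> 'a \<Rightarrow> 'a \<Rightarrow> 'a) \<Rightarrow> bool" where
  "cm_M2 mu \<longleftrightarrow> (\<forall>a b c.
      mu a b c = mu b a c \<and> mu a b c = mu a c b \<and> mu a b c = mu c b a \<and>
      mu a b c = mu b c a \<and> mu a b c = mu c a b)"

definition cm_C1 :: "('a::metric_space \<Rightarrow> 'a \<Rightarrow> 'a \<Rightarrow> 'a) \<Rightarrow> real \<Rightarrow> real \<Rightarrow> bool" where
  "cm_C1 mu K H0 \<longleftrightarrow> (\<forall>a b c a' b' c'.
      dist (mu a b c) (mu a' b' c') \<le> K * (dist a a' + dist b b' + dist c c') + H0)"

text \<open>Condition (C2), with an extra requirement Q on the approximating finite median algebra.
  Finite median algebras are represented on finite subsets of nat (every finite median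
  algebra is isomorphic to one of these).\<close>

definition cm_C2 :: "('a::metric_space \<Rightarrow> 'a \<Rightarrow> 'a \<Rightarrow> 'a) \<Rightarrow> (nat \<Rightarrow> real)
     \<Rightarrow> (nat set \<Rightarrow> (nat \<Rightarrow> nat \<Rightarrow> nat \<Rightarrow> nat) \<Rightarrow> bool) \<Rightarrow> bool" where
  "cm_C2 mu H Q \<longleftrightarrow> (\<forall>(p::nat) (A::'a set). finite A \<and> 1 \<le> card A \<and> card A \<le> p \<longrightarrow>
      (\<exists>(P::nat set) m (pi::'a \<Rightarrow> nat) (lam::nat \<Rightarrow> 'a).
         finite P \<and> median_algebra P m \<and> Q P m \<and> pi ` A \<subseteq> P \<and>
         (\<forall>x\<in>P. \<forall>y\<in>P. \<forall>z\<in>P. dist (lam (m x y z)) (mu (lam x) (lam y) (lam z)) \<le> H p) \<and>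
         (\<forall>a\<in>A. dist (lam (pi a)) a \<le> H p)))"

definition coarse_median_space :: "('a::metric_space \<Rightarrow> 'a \<Rightarrow> 'a \<Rightarrow> 'a) \<Rightarrow> bool" where
  "coarse_median_space mu \<longleftrightarrow> cm_M1 mu \<and> cm_M2 mu \<and>
     (\<exists>K H0. cm_C1 mu K H0) \<and> (\<exists>H. cm_C2 mu H (\<lambda>_ _. True))"

definition cm_rank_le :: "('a::metric_space \<Rightarrow> 'a \<Rightarrow> 'a \<Rightarrow> 'a) \<Rightarrow> nat \<Rightarrow> bool" where
  "cm_rank_le mu n \<longleftrightarrow>
     (\<exists>K H0 H. cm_C1 mu K H0 \<and> cm_C2 mu H (\<lambda>P m. median_rank_le P m n))"

definition cm_interval :: "('a \<Rightarrow> 'a \<Rightarrow> 'a \<Rightarrow> 'a) \<Rightarrow> 'a \<Rightarrow> 'a \<Rightarrow> 'a set" where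
  "cm_interval mu a b = {mu a y b | y. True}"

definition nbhd :: "real \<Rightarrow> 'a::metric_space set \<Rightarrow> 'a set" where
  "nbhd l S = {y. \<exists>s\<in>S. dist y s \<le> l}"

end

theory Submission
  imports Defs
begin

text \<open>If the rank is at most 1, approximate \<open>a\<close>, \<open>b\<close>, \<open>x\<close>, \<open>y\<close> by a finite median algebra of rank
  at most 1. Two incomparable points of an interval in a median algebra span a square together with
  their meet and join, so here \<open>x\<close> and \<open>y\<close> are comparable in the interval from \<open>a\<close> to \<open>b\<close>.

  Conversely, let \<open>\<lambda> : P \<rightarrow> X\<close> be an approximation of a finite set \<open>A\<close>, where \<open>P\<close> may be assumed
  to be generated by \<open>A\<close>. An edge of \<open>P\<close> divides it into two halfspaces. If two such divisions
  cross, then \<open>P\<close> contains a square with a corner in each of the four quadrants; intervals being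
  thin, two opposite sides of its image are short, and projecting them to the edge which they
  cross shows that the image of this edge is short. Hence long edges do not cross, and
  identifying the points of \<open>P\<close> that are not separated by a long edge leaves a median algebra of
  rank at most 1. As halfspaces are determined by their traces on \<open>A\<close>, there are at most \<open>2^|A|\<close>
  of them, which bounds the number of short edges between two identified points.\<close>

section \<open>Median algebras\<close>

text \<open>Equivalently, the indicator of \<open>S\<close> is a homomorphism to the two-element
  median algebra. The empty set and \<open>P\<close> itself count as halfspaces.\<close>

definition halfspace :: "'b set \<Rightarrow> ('b \<Rightarrow> 'b \<Rightarrow> 'b \<Rightarrow> 'b) \<Rightarrow> 'b set \<Rightarrow> bool" where
  "halfspace P m S \<longleftrightarrow> S \<subseteq> P \<and>
     (\<forall>x\<in>P. \<forall>y\<in>P. \<forall>z\<in>P. m x y z \<in> S \<longleftrightarrow>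
        x \<in> S \<and> y \<in> S \<or> y \<in> S \<and> z \<in> S \<or> x \<in> S \<and> z \<in> S)"

definition edge :: "'b set \<Rightarrow> ('b \<Rightarrow> 'b \<Rightarrow> 'b \<Rightarrow> 'b) \<Rightarrow> 'b \<Rightarrow> 'b \<Rightarrow> bool" where
  "edge P m u v \<longleftrightarrow> u \<in> P \<and> v \<in> P \<and> u \<noteq> v \<and> (\<forall>x\<in>P. m u v x = u \<or> m u v x = v)"

text \<open>The map \<open>m u v\<close> projects to the interval from \<open>u\<close> to
  \<open>v\<close>; for an edge this is the fibre over \<open>v\<close>.\<close>

definition side :: "'b set \<Rightarrow> ('b \<Rightarrow> 'b \<Rightarrow> 'b \<Rightarrow> 'b) \<Rightarrow> 'b \<Rightarrow> 'b \<Rightarrow> 'b set" where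
  "side P m u v = {x\<in>P. m u v x = v}"

definition crossing :: "'b set \<Rightarrow> 'b set \<Rightarrow> 'b set \<Rightarrow> bool" where
  "crossing P S T \<longleftrightarrow> (\<forall>i j. \<exists>x\<in>P. (x \<in> S \<longleftrightarrow> i) \<and> (x \<in> T \<longleftrightarrow> j))"

lemma halfspace_median_iff:
  assumes "halfspace P m S" "x \<in> P" "y \<in> P" "z \<in> P"
  shows "m x y z \<in> S \<longleftrightarrow> x \<in> S \<and> y \<in> S \<or> y \<in> S \<and> z \<in> S \<or> x \<in> S \<and> z \<in> S"
  using assms unfolding halfspace_def by blast

locale median =
  fixes P :: "'b set" and m :: "'b \<Rightarrow> 'b \<Rightarrow> 'b \<Rightarrow> 'b"
  assumes median_algebra: "median_algebra P m"
begin

lemma closed [simp]: "\<lbrakk>a \<in> P; b \<in> P; c \<in> P\<rbrakk> \<Longrightarrow> m a b c \<in> P"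
  using median_algebra unfolding median_algebra_def by blast

lemma swap12: "\<lbrakk>a \<in> P; b \<in> P; c \<in> P\<rbrakk> \<Longrightarrow> m a b c = m b a c"
  using median_algebra unfolding median_algebra_def by blast

lemma swap23: "\<lbrakk>a \<in> P; b \<in> P; c \<in> P\<rbrakk> \<Longrightarrow> m a b c = m a c b"
  using median_algebra unfolding median_algebra_def by blast

lemma idem [simp]:
  assumes "a \<in> P" "b \<in> P"
  shows "m a a b = a" "m a b a = a" "m b a a = a"
proof -
  show 1: "m a a b = a"
    using median_algebra assms unfolding median_algebra_def by blast
  show "m a b a = a" "m b a a = a"
    using 1 swap12 swap23 assms by metis+
qed

text \<open>For a fixed first argument, the median is a semilattice operation; nearly all computations
  below take place in one of these semilattices.\<close>

lemma assoc:
  assumes "b \<in> P" "x \<in> P" "y \<in> P" "z \<in> P"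
  shows "m b (m b x y) z = m b x (m b y z)"
proof -
  have "m (m x b y) b z = m x b (m y b z)"
    using median_algebra assms unfolding median_algebra_def by blast
  then show ?thesis
    using swap12 assms closed by metis
qed

lemma absorb:
  assumes "a \<in> P" "b \<in> P" "c \<in> P"
  shows "m a b (m a b c) = m a b c"
  using assoc[of a b b c] assms by simp

text \<open>In the semilattice based at \<open>y\<close>, the points \<open>b\<close> and
  \<open>a\<close> meet in the bottom \<open>y\<close>, and \<open>x\<close> lies below
  \<open>a\<close>; so \<open>b\<close> and \<open>x\<close> also meet in \<open>y\<close>. Thus the
  order of an interval is reversed when it is read from the other end.\<close>

lemma join_eq_if_meet_eq:
  assumes P: "a \<in> P" "b \<in> P" "x \<in> P" "y \<in> P"
    and y: "m a b y = y" and x: "m a x y = x"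
  shows "m b x y = y"
proof -
  have "m y b a = y" "m y a x = x"
    using x y swap12 swap23 P by metis+
  then have "m y b x = m y (m y b a) x"
    using assoc[of y b a x] P by simp
  also have "\<dots> = y"
    using \<open>m y b a = y\<close> P by simp
  finally show ?thesis
    using swap12 swap23 P by metis
qed

text \<open>In the semilattice based at \<open>x\<close>, the corners \<open>p\<close> and
  \<open>q\<close> are the meets of \<open>y\<close> with \<open>a\<close> and \<open>b\<close>, and
  these two already meet in the bottom \<open>x\<close>. The first two equations only say that
  \<open>p\<close> and \<open>q\<close> lie between \<open>x\<close> and \<open>y\<close>.\<close>

lemma square:
  assumes P: "a \<in> P" "b \<in> P" "x \<in> P" "y \<in> P" and x: "m a b x = x" and y: "m a b y = y"
  defines "p \<equiv> m a x y" and "q \<equiv> m b x y"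
  shows "m p x y = p" "m q x y = q" "m p x q = x" "m p y q = y"
proof -
  have PP: "p \<in> P" "q \<in> P"
    using P by (simp_all add: p_def q_def)
  have *: "m c x y = m x y (m x y c)" if "c \<in> P" for c
    using absorb[of x y c] swap12 swap23 that P closed by metis
  show "m p x y = p" "m q x y = q"
    using * P PP swap12 swap23 unfolding p_def q_def by metis+
  have **: "m (m a x y) x (m b x y) = x"
    if "x \<in> P" "y \<in> P" "m a b x = x" for x y
  proof -
    have "m x a b = x"
      using that P swap12 swap23 by metis
    have "m x (m x a y) (m x b y) = m x a (m x y (m x y b))"
      using assoc[of x a y] swap23[of x b y] that P by simp
    also have "\<dots> = m x a (m x b y)"
      using absorb[of x y b] swap23[of x b y] that P by simp
    also have "\<dots> = x"
      using assoc[of x a b y] \<open>m x a b = x\<close> that P by simp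
    finally show ?thesis
      using swap12 that P closed by metis
  qed
  show "m p x q = x"
    unfolding p_def q_def using ** P x by blast
  show "m p y q = y"
    using **[of y x] P y swap23[of a x y] swap23[of b x y] by (simp add: p_def q_def)
qed

text \<open>The median distributes over itself, but only this consequence is needed. Replacing
  \<open>v\<close> by its projection to the interval from \<open>u\<close> to \<open>w = m x y z\<close> and then \<open>x\<close>, \<open>y\<close> by
  theirs, one is in a lattice with bottom \<open>u\<close> and top \<open>w = x \<or> y\<close> in which \<open>v\<close> meets \<open>x\<close> and
  \<open>y\<close> trivially; the element \<open>t = m x y v\<close> then turns out to be \<open>x \<and> y\<close>.\<close>

lemma meet_bottom_aux:
  assumes P: "u \<in> P" "v \<in> P" "w \<in> P" "x \<in> P" "y \<in> P"
    and vw: "m u v w = v" and ux: "m u v x = u" and uy: "m u v y = u"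
    and x: "m u w x = x" and y: "m u w y = y" and w: "m w x y = w"
  shows "v = u"
proof -
  define t where "t = m x y v"
  have t: "t \<in> P"
    using P by (simp add: t_def)
  have 1: "m x u t = m x u y"
  proof -
    have "m x u t = m x (m x u v) y"
      using assoc[of x u v y] swap23[of x y v] P by (simp add: t_def)
    moreover have "m x u v = u"
      using ux P swap12 swap23 by metis
    ultimately show ?thesis by simp
  qed
  have 2: "m y u t = m y u x"
  proof -
    have "m y u t = m y (m y u v) x"
      using assoc[of y u v x] P swap12 swap23 closed unfolding t_def by metis
    moreover have "m y u v = u"
      using uy P swap12 swap23 by metis
    ultimately show ?thesis by simp
  qed
  have 3: "m t u x = m t u y"
    using 1 2 P t swap12 swap23 by metis
  have 4: "m t x y = t"
    using absorb[of x y v] P t swap12 swap23 unfolding t_def by metis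
  have "m t u x = m t u (m t x y)"
  proof -
    have "m t u (m t x y) = m t (m t u x) y"
      using assoc[of t u x y] P t by simp
    also have "\<dots> = m t (m t u y) y"
      using 3 by simp
    also have "\<dots> = m t u y"
      using assoc[of t u y y] P t by simp
    finally show ?thesis using 3 by simp
  qed
  then have 5: "m t u x = t"
    using 4 P t by simp
  have "m x w t = x"
  proof -
    have "m x u t = t"
      using 5 P t swap12 swap23 by metis
    then have "m x w t = m x (m x w u) t"
      using assoc[of x w u t] P t by simp
    moreover have "m x w u = x"
      using x P swap12 swap23 by metis
    ultimately show ?thesis using P t by simp
  qed
  moreover have "m x w t = m x w v"
  proof -
    have "m x w t = m x (m x w y) v"
      using assoc[of x w y v] P by (simp add: t_def)
    moreover have "m x w y = w"
      using w P swap12 swap23 by metis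
    ultimately show ?thesis by simp
  qed
  ultimately have 6: "m v w x = x"
    using P swap12 swap23 by metis
  have "m v u w = v"
    using vw P swap12 by metis
  then have "m v u x = v"
    using assoc[of v u w x] 6 P by simp
  then show ?thesis
    using ux P swap12 by metis
qed

text \<open>Projecting \<open>v\<close>, \<open>x\<close> and \<open>y\<close> to the interval from
  \<open>u\<close> to \<open>w\<close> keeps the meets with \<open>v\<close> trivial and makes
  \<open>w\<close> the join of \<open>x'\<close> and \<open>y'\<close>, which is the situation of
  \<open>meet_bottom_aux\<close>.\<close>

lemma meet_bottom_convex:
  assumes P: "u \<in> P" "v \<in> P" "x \<in> P" "y \<in> P" "z \<in> P"
    and x: "m u v x = u" and y: "m u v y = u"
  shows "m u v (m x y z) = u"
proof -
  define w where "w = m x y z"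
  define v' where "v' = m u v w"
  define x' where "x' = m u w x"
  define y' where "y' = m u w y"
  have P': "w \<in> P" "v' \<in> P" "x' \<in> P" "y' \<in> P"
    using P by (simp_all add: w_def v'_def x'_def y'_def)
  have meet: "m u v' (m u w c) = u" if "c \<in> P" "m u v c = u" for c
  proof -
    have "m u v' (m u w c) = m u v (m u w c)"
      using assoc[of u v w "m u w c"] absorb[of u w c] that P P' by (simp add: v'_def)
    also have "\<dots> = m u (m u v c) w"
      using assoc[of u v c w] swap23[of u w c] that P P' by simp
    also have "\<dots> = u"
      using that P P' by simp
    finally show ?thesis .
  qed
  have "m w x' y' = w"
  proof -
    have xyw: "m w x y = w"
      using absorb[of x y z] P P' swap12 swap23 unfolding w_def by metis
    have "x' = m w u x" "y' = m w u y"
      using P P' swap12 swap23 unfolding x'_def y'_def by metis+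
    then have "m w x' y' = m w u (m w x (m w y u))"
      using assoc[of w u x y'] swap23[of w u y] P P' by simp
    also have "\<dots> = m w u (m w w u)"
      using assoc[of w x y u] xyw P P' by simp
    also have "\<dots> = w"
      using P P' by simp
    finally show ?thesis .
  qed
  moreover have "m u v' w = v'"
    using absorb[of u w v] P P' swap23 unfolding v'_def by metis
  moreover have "m u w x' = x'" "m u w y' = y'"
    using absorb P P' by (simp_all add: x'_def y'_def)
  moreover have "m u v' x' = u" "m u v' y' = u"
    using meet x y P by (simp_all add: x'_def y'_def)
  ultimately have "v' = u"
    using meet_bottom_aux[of u v' w x' y'] P P' by blast
  then show ?thesis
    by (simp add: v'_def w_def)
qed

section \<open>Edges and the halfspaces they define\<close>

text \<open>Among three points two have the same projection to the edge, and by
  \<open>meet_bottom_convex\<close>, used for both orientations of the edge, the median projects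
  there as well.\<close>

lemma halfspace_side:
  assumes e: "edge P m u v"
  shows "halfspace P m (side P m u v)"
proof -
  have uv: "u \<in> P" "v \<in> P" "u \<noteq> v"
    and cases: "\<And>x. x \<in> P \<Longrightarrow> m u v x = u \<or> m u v x = v"
    using e unfolding edge_def by auto
  have u: "m u v (m x y z) = u"
    if "x \<in> P" "y \<in> P" "z \<in> P" "m u v x = u" "m u v y = u" for x y z
    using that uv meet_bottom_convex by blast
  have v: "m u v (m x y z) = v"
    if "x \<in> P" "y \<in> P" "z \<in> P" "m u v x = v" "m u v y = v" for x y z
    using that uv meet_bottom_convex[of v u x y z] swap12 closed by metis
  have perm: "m x y z = m y z x" "m x y z = m x z y" if "x \<in> P" "y \<in> P" "z \<in> P" for x y z
    using that swap12 swap23 by metis+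
  have "m u v (m x y z) = v \<longleftrightarrow> m u v x = v \<and> m u v y = v \<or> m u v y = v \<and> m u v z = v
      \<or> m u v x = v \<and> m u v z = v" if P: "x \<in> P" "y \<in> P" "z \<in> P" for x y z
    using cases[OF P(1)] cases[OF P(2)] cases[OF P(3)] u[of x y z] u[of y z x] u[of x z y]
      v[of x y z] v[of y z x] v[of x z y] perm[OF P] P uv(3) by metis
  then show ?thesis
    unfolding halfspace_def side_def by auto
qed

lemma edge_side:
  assumes "edge P m u v"
  shows "u \<notin> side P m u v" "v \<in> side P m u v"
  using assms unfolding edge_def side_def by auto

text \<open>Among the points other than \<open>x\<close> between \<open>x\<close> and
  \<open>y\<close>, take \<open>v\<close> with the smallest interval \<open>I v\<close> from
  \<open>x\<close> to \<open>v\<close>: a further point inside it would have a strictly smaller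
  interval.\<close>

lemma exists_edge_towards:
  assumes "finite P" and P: "x \<in> P" "y \<in> P" and "x \<noteq> y"
  obtains v where "edge P m x v" "m x y v = v"
proof -
  define I where "I v = {s\<in>P. m x v s = s}" for v
  define Q where "Q v \<longleftrightarrow> v \<in> P \<and> v \<noteq> x \<and> m x y v = v" for v
  have "Q y"
    using assms by (simp add: Q_def)
  then obtain v where v: "Q v" and min: "\<And>s. Q s \<Longrightarrow> card (I v) \<le> card (I s)"
    using ex_has_least_nat[of Q y "\<lambda>v. card (I v)"] by blast
  have vP: "v \<in> P" "v \<noteq> x" "m x y v = v"
    using v by (auto simp: Q_def)
  have "m x v z = x \<or> m x v z = v" if z: "z \<in> P" for z
  proof (rule disjCI)
    define s where "s = m x v z"
    assume "m x v z \<noteq> v"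
    then have sv: "s \<noteq> v" by (simp add: s_def)
    have sP: "s \<in> P" using P vP z by (simp add: s_def)
    have vs: "m x v s = s"
      using absorb[of x v z] P vP z by (simp add: s_def)
    have "m x y s = s"
      using assoc[of x y v s] vs vP P sP by simp
    have "I s \<subseteq> I v"
      using assoc[of x v s] vs P vP sP unfolding I_def by fastforce
    moreover have "v \<in> I v" using P vP by (simp add: I_def)
    moreover have "v \<notin> I s"
      using swap23[of x s v] vs sv P vP sP by (auto simp: I_def)
    ultimately have "I s \<subset> I v" by blast
    moreover have "finite (I v)" using \<open>finite P\<close> by (simp add: I_def)
    ultimately have "\<not> Q s"
      using min psubset_card_mono by (metis leD)
    then show "m x v z = x"
      using \<open>m x y s = s\<close> sP by (simp add: Q_def s_def)
  qed
  then show thesis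
    using that[of v] P vP unfolding edge_def by blast
qed

end

section \<open>Squares and rank at most one\<close>

text \<open>Incomparable \<open>x\<close> and \<open>y\<close> together with their meet
  \<open>p\<close> and join \<open>q\<close> would be a copy of the square
  \<open>cube 2\<close>.\<close>

lemma rank_one_comparable:
  assumes "median_algebra P m" "median_rank_le P m 1"
    and P: "a \<in> P" "b \<in> P" "x \<in> P" "y \<in> P" and x: "m a b x = x" and y: "m a b y = y"
  shows "m a x y = x \<or> m a x y = y"
proof (rule ccontr)
  assume neq: "\<not> ?thesis"
  interpret median P m by unfold_locales fact
  define p where "p = m a x y"
  define q where "q = m b x y"
  have PP: "p \<in> P" "q \<in> P"
    using P by (simp_all add: p_def q_def)
  have sq: "m p x y = p" "m q x y = q" "m p x q = x" "m p y q = y"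
    using square[OF P x y] by (simp_all add: p_def q_def)
  have pn: "p \<noteq> x" "p \<noteq> y"
    using neq by (simp_all add: p_def)
  have xy: "x \<noteq> y"
    using neq P by auto
  have "m b a x = x" "m b a y = y"
    using x y swap12 P by metis+
  \<comment> \<open>If the join were one of the two points, they would be comparable as seen from
    \<open>b\<close>, hence also from \<open>a\<close>.\<close>
  then have "q \<noteq> x" "q \<noteq> y"
    using join_eq_if_meet_eq[of b a x y] join_eq_if_meet_eq[of b a y x] neq P
      swap23[of a x y] swap23[of b x y] by (auto simp: q_def)
  moreover have "p \<noteq> q"
    using sq(3) pn(1) PP P by auto
  note distinct = pn xy calculation this
  define \<phi> where "\<phi> f = (if f 0 then if f 1 then q else x else if f 1 then y else p)"
    for f :: "nat \<Rightarrow> bool"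
  have "inj_on \<phi> (cube 2)"
  proof (rule inj_onI, rule ext)
    fix f g and i :: nat assume fg: "f \<in> cube 2" "g \<in> cube 2" "\<phi> f = \<phi> g"
    then have "f 0 = g 0" "f 1 = g 1"
      using distinct by (auto simp: \<phi>_def split: if_splits)
    moreover have "i = 0 \<or> i = 1 \<or> i \<ge> 2" by arith
    ultimately show "f i = g i"
      using fg by (auto simp: cube_def)
  qed
  moreover have "\<phi> ` cube 2 \<subseteq> P"
    using P PP by (auto simp: \<phi>_def)
  moreover have "\<phi> (majority f g h) = m (\<phi> f) (\<phi> g) (\<phi> h)" for f g h
  proof -
    have perms: "m y x p = p" "m x p y = p" "m x y p = p" "m y p x = p" "m p y x = p"
      "m y x q = q" "m x q y = q" "m x y q = q" "m y q x = q" "m q y x = q"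
      "m x p q = x" "m x q p = x" "m p q x = x" "m q p x = x" "m q x p = x"
      "m y p q = y" "m y q p = y" "m p q y = y" "m q p y = y" "m q y p = y"
      using sq P PP swap12 swap23 by metis+
    show ?thesis
      using P PP sq perms by (simp add: \<phi>_def majority_def)
  qed
  ultimately have "contains_cube P m 2"
    unfolding contains_cube_def by blast
  then show False
    using assms(2) unfolding median_rank_le_def by fastforce
qed

section \<open>Collapsing walls\<close>

text \<open>The quotient is realised on a set of representatives, so that the carrier stays inside
  \<open>P\<close>.\<close>

lemma collapse_to_noncrossing:
  assumes "median_algebra P m"
    and half: "\<And>S. S \<in> W \<Longrightarrow> halfspace P m S"
    and nocross: "\<And>S T. \<lbrakk>S \<in> W; T \<in> W\<rbrakk> \<Longrightarrow> \<not> crossing P S T"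
  obtains \<sigma> where "\<And>x. x \<in> P \<Longrightarrow> \<sigma> x \<in> P"
    "\<And>x S. \<lbrakk>x \<in> P; S \<in> W\<rbrakk> \<Longrightarrow> \<sigma> x \<in> S \<longleftrightarrow> x \<in> S"
    "median_algebra (\<sigma> ` P) (\<lambda>x y z. \<sigma> (m x y z))"
    "median_rank_le (\<sigma> ` P) (\<lambda>x y z. \<sigma> (m x y z)) 1"
proof -
  interpret median P m by unfold_locales fact
  \<comment> \<open>The chosen point depends only on which members of \<open>W\<close> contain
    \<open>x\<close>, so \<open>\<sigma>\<close> is constant on classes.\<close>
  define \<sigma> where "\<sigma> x = (SOME y. y \<in> P \<and> (\<forall>S\<in>W. y \<in> S \<longleftrightarrow> x \<in> S))" for x
  define M where "M = (\<lambda>x y z. \<sigma> (m x y z))"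
  have \<sigma>: "\<sigma> x \<in> P \<and> (\<forall>S\<in>W. \<sigma> x \<in> S \<longleftrightarrow> x \<in> S)" if "x \<in> P" for x
    unfolding \<sigma>_def by (rule someI[of _ x]) (use that in simp)
  have \<sigma>_eq: "\<sigma> x = \<sigma> y" if "\<forall>S\<in>W. x \<in> S \<longleftrightarrow> y \<in> S" for x y
    unfolding \<sigma>_def using that by simp
  have eqI: "x = y" if xy: "x \<in> \<sigma> ` P" "y \<in> \<sigma> ` P" "\<And>S. S \<in> W \<Longrightarrow> x \<in> S \<longleftrightarrow> y \<in> S" for x y
  proof -
    obtain x' y' where *: "x' \<in> P" "y' \<in> P" "x = \<sigma> x'" "y = \<sigma> y'"
      using xy by blast
    then have "\<forall>S\<in>W. x' \<in> S \<longleftrightarrow> y' \<in> S"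
      using xy(3) \<sigma> by blast
    then show ?thesis
      using \<sigma>_eq * by blast
  qed
  have sub: "x \<in> P" if "x \<in> \<sigma> ` P" for x
    using that \<sigma> by blast
  have M_closed: "M x y z \<in> \<sigma> ` P" if "x \<in> \<sigma> ` P" "y \<in> \<sigma> ` P" "z \<in> \<sigma> ` P" for x y z
    using that sub by (simp add: M_def)
  have M_iff: "M x y z \<in> S \<longleftrightarrow> x \<in> S \<and> y \<in> S \<or> y \<in> S \<and> z \<in> S \<or> x \<in> S \<and> z \<in> S"
    if "S \<in> W" "x \<in> \<sigma> ` P" "y \<in> \<sigma> ` P" "z \<in> \<sigma> ` P" for x y z S
    using that \<sigma>[of "m x y z"] sub halfspace_median_iff[OF half] by (simp add: M_def)
  \<comment> \<open>Points are determined by their memberships in \<open>W\<close>, on which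
    \<open>M\<close> acts by majority vote; each axiom thus reduces to a Boolean identity.\<close>
  have "median_algebra (\<sigma> ` P) M"
    unfolding median_algebra_def
    by (intro conjI ballI; (rule M_closed | rule eqI); auto simp: M_iff M_closed)
  moreover have "median_rank_le (\<sigma> ` P) M 1"
    unfolding median_rank_le_def
  proof (intro allI impI, rule ccontr)
    fix k assume "contains_cube (\<sigma> ` P) M k" "\<not> k \<le> 1"
    then obtain \<phi> where inj: "inj_on \<phi> (cube k)" and ran: "\<phi> ` cube k \<subseteq> \<sigma> ` P"
      and hom: "\<And>x y z. \<lbrakk>x \<in> cube k; y \<in> cube k; z \<in> cube k\<rbrakk> \<Longrightarrow>
        \<phi> (majority x y z) = M (\<phi> x) (\<phi> y) (\<phi> z)" and k: "k \<ge> 2"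
      unfolding contains_cube_def by auto
    define c :: "bool \<Rightarrow> bool \<Rightarrow> nat \<Rightarrow> bool"
      where "c i j = (\<lambda>n. n = 0 \<and> i \<or> n = 1 \<and> j)" for i j
    have c: "c i j \<in> cube k" for i j
      using k by (auto simp: c_def cube_def)
    have c_maj: "majority (c i j) (c i' j') (c i'' j'') =
        c (i \<and> i' \<or> i' \<and> i'' \<or> i \<and> i'') (j \<and> j' \<or> j' \<and> j'' \<or> j \<and> j'')" for i j i' j' i'' j''
      by (auto simp: c_def majority_def)
    define s where "s i j = \<phi> (c i j)" for i j
    have s: "s i j \<in> \<sigma> ` P" for i j
      using ran c by (auto simp: s_def)
    have s_maj: "s (i \<and> i' \<or> i' \<and> i'' \<or> i \<and> i'') (j \<and> j' \<or> j' \<and> j'' \<or> j \<and> j'') =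
        M (s i j) (s i' j') (s i'' j'')" for i j i' j' i'' j''
      unfolding s_def using hom[OF c c c] c_maj by metis
    have "c True False \<noteq> c False False" "c False True \<noteq> c False False"
      by (auto simp: c_def fun_eq_iff)
    then have "s True False \<noteq> s False False" "s False True \<noteq> s False False"
      unfolding s_def using inj c by (meson inj_on_eq_iff)+
    then obtain S T where S: "S \<in> W" "s True False \<in> S \<longleftrightarrow> s False False \<notin> S"
      and T: "T \<in> W" "s False True \<in> T \<longleftrightarrow> s False False \<notin> T"
      using eqI s by metis
    \<comment> \<open>Since \<open>S\<close> separates the ends of one side of the square, these
      medians force the opposite corners to follow: \<open>S\<close> splits the square along the
      first coordinate, and \<open>T\<close> along the second.\<close>
    have corners: "s False False = M (s False False) (s True False) (s False True)"
      "s True False = M (s False False) (s True False) (s True True)"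
      "s False True = M (s False False) (s False True) (s True True)"
      using s_maj[of False True False False False True] s_maj[of False True True False False True]
        s_maj[of False False True False True True] by simp_all
    have S': "s False True \<in> S \<longleftrightarrow> s False False \<in> S" "s True True \<in> S \<longleftrightarrow> s False False \<notin> S"
      using M_iff[OF S(1) s s s] corners S(2) by metis+
    have T': "s True False \<in> T \<longleftrightarrow> s False False \<in> T" "s True True \<in> T \<longleftrightarrow> s False False \<notin> T"
      using M_iff[OF T(1) s s s] corners T(2) by metis+
    have "crossing P S T"
      unfolding crossing_def
    proof (intro allI)
      fix i j
      show "\<exists>x\<in>P. (x \<in> S \<longleftrightarrow> i) \<and> (x \<in> T \<longleftrightarrow> j)"
        \<comment> \<open>The inequality of truth values is an exclusive or: a coordinate is
          switched on exactly when the wanted quadrant differs from that of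
          \<open>s False False\<close>.\<close>
        by (rule bexI[OF _ sub[OF s[of "i \<noteq> (s False False \<in> S)" "j \<noteq> (s False False \<in> T)"]]])
          (cases i; cases j; cases "s False False \<in> S"; cases "s False False \<in> T";
            simp add: S S' T T')
    qed
    then show False
      using nocross S T by blast
  qed
  ultimately show thesis
    using that[of \<sigma>] \<sigma> by (simp add: M_def)
qed

section \<open>Generating sets and the number of halfspaces\<close>

definition generated :: "'b set \<Rightarrow> ('b \<Rightarrow> 'b \<Rightarrow> 'b \<Rightarrow> 'b) \<Rightarrow> 'b set \<Rightarrow> bool" where
  "generated P m B \<longleftrightarrow> B \<subseteq> P \<and>
     (\<forall>Q. B \<subseteq> Q \<and> Q \<subseteq> P \<and> (\<forall>x\<in>Q. \<forall>y\<in>Q. \<forall>z\<in>Q. m x y z \<in> Q) \<longrightarrow> Q = P)"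

lemma exists_generated_subalgebra:
  assumes "median_algebra P m" "B \<subseteq> P"
  obtains Q where "Q \<subseteq> P" "median_algebra Q m" "generated Q m B"
proof -
  define F where "F = {Q. B \<subseteq> Q \<and> Q \<subseteq> P \<and> (\<forall>x\<in>Q. \<forall>y\<in>Q. \<forall>z\<in>Q. m x y z \<in> Q)}"
  have PF: "P \<in> F"
    using assms by (simp add: F_def median_algebra_def)
  have F: "\<Inter>F \<in> F"
    using PF unfolding F_def by blast
  show thesis
  proof
    show QP: "\<Inter>F \<subseteq> P" using PF by blast
    have "\<forall>x\<in>\<Inter>F. \<forall>y\<in>\<Inter>F. \<forall>z\<in>\<Inter>F. m x y z \<in> \<Inter>F"
      using F unfolding F_def by blast
    moreover have "\<And>x. x \<in> \<Inter>F \<Longrightarrow> x \<in> P" using QP by blast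
    ultimately show "median_algebra (\<Inter>F) m"
      using assms(1) unfolding median_algebra_def by meson
    have "Q = \<Inter>F" if "B \<subseteq> Q" "Q \<subseteq> \<Inter>F" "\<forall>x\<in>Q. \<forall>y\<in>Q. \<forall>z\<in>Q. m x y z \<in> Q" for Q
    proof (rule antisym[OF \<open>Q \<subseteq> \<Inter>F\<close>])
      have "Q \<in> F" using that QP by (simp add: F_def)
      then show "\<Inter>F \<subseteq> Q" by blast
    qed
    then show "generated (\<Inter>F) m B"
      using F unfolding generated_def by (simp add: F_def)
  qed
qed

text \<open>The points on which two halfspaces agree form a subalgebra, so agreement on the
  generators is agreement everywhere. Halfspaces therefore inject into the subsets of
  \<open>A\<close>.\<close>

lemma card_halfspaces_le:
  assumes "median_algebra P m" and gen: "generated P m (f ` A)" and "finite A"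
  shows "finite {S. halfspace P m S}" "card {S. halfspace P m S} \<le> 2 ^ card A"
proof -
  let ?r = "\<lambda>S. {a\<in>A. f a \<in> S}"
  have inj: "inj_on ?r {S. halfspace P m S}"
  proof (rule inj_onI)
    fix S T assume ST: "S \<in> {S. halfspace P m S}" "T \<in> {S. halfspace P m S}" and eq: "?r S = ?r T"
    let ?Q = "{x\<in>P. x \<in> S \<longleftrightarrow> x \<in> T}"
    have "f ` A \<subseteq> ?Q"
      using eq gen unfolding generated_def by blast
    moreover have "\<forall>x\<in>?Q. \<forall>y\<in>?Q. \<forall>z\<in>?Q. m x y z \<in> ?Q"
      using ST assms(1) by (auto simp: halfspace_median_iff median_algebra_def)
    ultimately have "?Q = P"
      using gen unfolding generated_def by blast
    then show "S = T"
      using ST unfolding halfspace_def by blast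
  qed
  have ran: "?r ` {S. halfspace P m S} \<subseteq> Pow A" by blast
  have fin: "finite (Pow A)" using \<open>finite A\<close> by simp
  show "finite {S. halfspace P m S}"
    using inj ran fin by (meson finite_imageD finite_subset)
  show "card {S. halfspace P m S} \<le> 2 ^ card A"
    using card_inj_on_le[OF inj ran fin] card_Pow[OF \<open>finite A\<close>] by simp
qed

text \<open>Walk from \<open>x\<close> to \<open>y\<close> along edges pointing towards
  \<open>y\<close>. Each step crosses a halfspace separating \<open>x\<close> from \<open>y\<close>,
  none is crossed twice, and each edge costs at most \<open>L\<close>.\<close>

lemma dist_le_card_separating:
  fixes lam :: "'b \<Rightarrow> 'a::metric_space"
  assumes "median_algebra P m" "finite P" "x \<in> P" "y \<in> P"
    and "\<And>u v. \<lbrakk>edge P m u v; x \<notin> side P m u v; y \<in> side P m u v\<rbrakk> \<Longrightarrow> dist (lam u) (lam v) \<le> L"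
    and "L \<ge> 0"
  shows "dist (lam x) (lam y) \<le> L * card {S. halfspace P m S \<and> x \<notin> S \<and> y \<in> S}"
  using assms(3-5)
proof (induction "card {S. halfspace P m S \<and> x \<notin> S \<and> y \<in> S}" arbitrary: x rule: less_induct)
  case less
  interpret median P m by unfold_locales fact
  let ?sep = "\<lambda>x. {S. halfspace P m S \<and> x \<notin> S \<and> y \<in> S}"
  have fin: "finite (?sep x)"
    by (rule finite_subset[of _ "Pow P"]) (use \<open>finite P\<close> in \<open>auto simp: halfspace_def\<close>)
  show ?case
  proof (cases "x = y")
    case False
    then obtain v where e: "edge P m x v" and v: "m x y v = v"
      using exists_edge_towards[OF \<open>finite P\<close> less.prems(1,2)] by blast
    have vP: "v \<in> P" using e by (simp add: edge_def)
    have "m x v y = v"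
      using v swap23[of x y v] vP less.prems by simp
    then have y: "y \<in> side P m x v"
      using less.prems by (simp add: side_def)
    \<comment> \<open>As \<open>v\<close> lies between \<open>x\<close> and \<open>y\<close>,
      whatever separates \<open>v\<close> from \<open>y\<close> separates \<open>x\<close> from
      \<open>y\<close>; this also passes the bound on edges to the rest of the walk.\<close>
    have mono: "x \<notin> S" if "halfspace P m S" "v \<notin> S" "y \<in> S" for S
      using halfspace_median_iff[OF that(1) less.prems(1,2) vP] that v by auto
    have "?sep v \<subseteq> ?sep x" using mono by blast
    moreover have "side P m x v \<in> ?sep x" "side P m x v \<notin> ?sep v"
      using y halfspace_side[OF e] edge_side[OF e] by auto
    ultimately have "?sep v \<subset> ?sep x" by blast
    then have lt: "card (?sep v) < card (?sep x)"
      using fin psubset_card_mono by blast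
    have "dist (lam v) (lam y) \<le> L * card (?sep v)"
      using less.hyps[OF lt vP less.prems(2)] less.prems(3) mono halfspace_side by blast
    moreover have "dist (lam x) (lam v) \<le> L"
      using less.prems(3)[OF e] edge_side[OF e] y by blast
    moreover have "L * card (?sep v) + L \<le> L * card (?sep x)"
    proof -
      have "L * (real (card (?sep v)) + 1) \<le> L * card (?sep x)"
        using lt \<open>L \<ge> 0\<close> by (intro mult_left_mono) auto
      then show ?thesis by (simp add: algebra_simps)
    qed
    ultimately show ?thesis
      using dist_triangle[of "lam x" "lam y" "lam v"] by linarith
  qed (simp add: \<open>L \<ge> 0\<close>)
qed

section \<open>Coarse medians\<close>

definition quasi_hom :: "'b set \<Rightarrow> ('b \<Rightarrow> 'b \<Rightarrow> 'b \<Rightarrow> 'b) \<Rightarrow> ('a::metric_space \<Rightarrow> 'a \<Rightarrow> 'a \<Rightarrow> 'a)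
    \<Rightarrow> ('b \<Rightarrow> 'a) \<Rightarrow> real \<Rightarrow> bool" where
  "quasi_hom P m mu lam h \<longleftrightarrow>
     (\<forall>x\<in>P. \<forall>y\<in>P. \<forall>z\<in>P. dist (lam (m x y z)) (mu (lam x) (lam y) (lam z)) \<le> h)"

lemma quasi_homD:
  assumes "quasi_hom P m mu lam h" "x \<in> P" "y \<in> P" "z \<in> P"
  shows "dist (lam (m x y z)) (mu (lam x) (lam y) (lam z)) \<le> h"
  using assms unfolding quasi_hom_def by blast

lemma cm_C2_iff:
  "cm_C2 mu H Q \<longleftrightarrow> (\<forall>p A. finite A \<and> 1 \<le> card A \<and> card A \<le> p \<longrightarrow>
     (\<exists>P m pi lam. finite P \<and> median_algebra P m \<and> Q P m \<and> pi ` A \<subseteq> P \<and>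
        quasi_hom P m mu lam (H p) \<and> (\<forall>a\<in>A. dist (lam (pi a)) a \<le> H p)))"
  unfolding cm_C2_def quasi_hom_def by simp

lemma cm_C2E:
  assumes "cm_C2 mu H Q" "finite A \<and> 1 \<le> card A \<and> card A \<le> p"
  obtains P m pi lam where "finite P" "median_algebra P m" "Q P m" "pi ` A \<subseteq> P"
    "quasi_hom P m mu lam (H p)" "\<forall>a\<in>A. dist (lam (pi a)) a \<le> H p"
  using assms unfolding cm_C2_iff by metis

text \<open>With \<open>K\<close> non-negative, upper bounds on distances may be inserted into (C1);
  \<open>lipschitz_median_abs\<close> provides this.\<close>

locale lipschitz_median =
  fixes mu :: "'a::metric_space \<Rightarrow> 'a \<Rightarrow> 'a \<Rightarrow> 'a" and K H0 :: real
  assumes M2: "cm_M2 mu" and C1: "cm_C1 mu K H0" and K: "K \<ge> 0"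
begin

lemma mu_swap: "mu a b c = mu b a c" "mu a b c = mu a c b"
  using M2 unfolding cm_M2_def by blast+

lemma mu_close:
  assumes "dist a a' \<le> r" "dist b b' \<le> s" "dist c c' \<le> t"
  shows "dist (mu a b c) (mu a' b' c') \<le> K * (r + s + t) + H0"
proof -
  have "dist (mu a b c) (mu a' b' c') \<le> K * (dist a a' + dist b b' + dist c c') + H0"
    using C1 unfolding cm_C1_def by blast
  also have "\<dots> \<le> K * (r + s + t) + H0"
    using assms K by (intro add_right_mono mult_left_mono) auto
  finally show ?thesis .
qed

lemma quasi_hom_median_close:
  assumes "quasi_hom P m mu lam h" "x \<in> P" "y \<in> P" "z \<in> P"
    and "dist (lam x) a \<le> r" "dist (lam y) b \<le> s" "dist (lam z) c \<le> t"
  shows "dist (lam (m x y z)) (mu a b c) \<le> h + (K * (r + s + t) + H0)"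
  using quasi_homD[OF assms(1-4)] mu_close[OF assms(5-7)]
    dist_triangle[of "lam (m x y z)" "mu a b c" "mu (lam x) (lam y) (lam z)"] by linarith

section \<open>From rank at most one to thin intervals\<close>

lemma thin_if_rank_one:
  assumes C2: "cm_C2 mu H (\<lambda>P m. median_rank_le P m 1)"
  obtains l where "\<And>a b x. x \<in> cm_interval mu a b \<Longrightarrow>
    cm_interval mu a b \<subseteq> nbhd l (cm_interval mu a x) \<union> nbhd l (cm_interval mu x b)"
proof -
  \<comment> \<open>Four points are approximated. \<open>E\<close> is the error of the images of
    \<open>X\<close> and \<open>Y\<close>, and the second summand of \<open>l\<close> is that of one
    further median with two arguments known up to \<open>E\<close>.\<close>
  define h where "h = H 4"
  define E where "E = h + (K * (h + h + h) + H0)"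
  define l where "l = E + (h + (K * (h + E + E) + H0))"
  have "y \<in> nbhd l (cm_interval mu a x) \<union> nbhd l (cm_interval mu x b)"
    if xy: "x \<in> cm_interval mu a b" "y \<in> cm_interval mu a b" for a b x y
  proof -
    obtain x' y' where x: "x = mu a b x'" and y: "y = mu a b y'"
      using xy mu_swap(2) unfolding cm_interval_def by blast
    let ?A = "{a, b, x', y'}"
    have "card ?A \<le> 4"
      using card_length[of "[a, b, x', y']"] by simp
    moreover have "1 \<le> card ?A"
      by (simp add: Suc_le_eq card_gt_0_iff)
    ultimately have A: "finite ?A \<and> 1 \<le> card ?A \<and> card ?A \<le> 4"
      by simp
    obtain P :: "nat set" and m pi lam where Pm: "median_algebra P m" "median_rank_le P m 1"
      and pi: "pi ` ?A \<subseteq> P" and lam: "quasi_hom P m mu lam h" "\<forall>c\<in>?A. dist (lam (pi c)) c \<le> h"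
      by (rule cm_C2E[OF C2 A, folded h_def]) (rule that)
    interpret median P m by unfold_locales fact
    have P: "pi a \<in> P" "pi b \<in> P" "pi x' \<in> P" "pi y' \<in> P"
      using pi by auto
    have close: "dist (lam (pi a)) a \<le> h" "dist (lam (pi b)) b \<le> h" "dist (lam (pi x')) x' \<le> h"
      "dist (lam (pi y')) y' \<le> h"
      using lam(2) by auto
    \<comment> \<open>Approximating \<open>x'\<close> and \<open>y'\<close> instead of
      \<open>x\<close> and \<open>y\<close> makes \<open>X\<close> and \<open>Y\<close> lie exactly
      in an interval of \<open>P\<close>.\<close>
    define X where "X = m (pi a) (pi b) (pi x')"
    define Y where "Y = m (pi a) (pi b) (pi y')"
    have XY: "X \<in> P" "Y \<in> P"
      using P by (simp_all add: X_def Y_def)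
    have dX: "dist (lam X) x \<le> E" and dY: "dist (lam Y) y \<le> E"
      unfolding X_def Y_def x y E_def by (intro quasi_hom_median_close[OF lam(1)] P close)+
    have iX: "m (pi a) (pi b) X = X" and iY: "m (pi a) (pi b) Y = Y"
      using absorb P by (simp_all add: X_def Y_def)
    have near: "dist y (mu c x y) \<le> l" if "c \<in> {a, b}" "m (pi c) X Y = Y" for c
    proof -
      have "dist (lam (m (pi c) X Y)) (mu c x y) \<le> h + (K * (h + E + E) + H0)"
        using that close P by (intro quasi_hom_median_close[OF lam(1)] XY dX dY) auto
      then show ?thesis
        using that dY dist_triangle[of y "mu c x y" "lam Y"]
        by (simp add: l_def dist_commute)
    qed
    have "mu a x y = mu a y x" "mu b x y = mu x y b"
      using mu_swap by metis+
    then have "mu a x y \<in> cm_interval mu a x" "mu b x y \<in> cm_interval mu x b"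
      unfolding cm_interval_def by blast+
    \<comment> \<open>If instead \<open>X\<close> lies below \<open>Y\<close> as seen from
      \<open>pi a\<close>, then \<open>Y\<close> lies below \<open>X\<close> as seen from
      \<open>pi b\<close>.\<close>
    moreover have "m (pi a) X Y = Y \<or> m (pi b) X Y = Y"
      using rank_one_comparable[OF Pm P(1,2) XY iX iY]
        join_eq_if_meet_eq[OF P(1,2) XY iY] by blast
    ultimately show ?thesis
      using near unfolding nbhd_def by auto
  qed
  then show thesis
    using that[of l] by blast
qed

section \<open>From thin intervals to rank at most one\<close>

text \<open>The exact identity \<open>absorb\<close>, read in an approximation of three points,
  survives with bounded error.\<close>

lemma absorb_coarse:
  assumes C2: "cm_C2 mu H (\<lambda>_ _. True)"
  obtains C where "\<And>a b c. dist (mu a b (mu a b c)) (mu a b c) \<le> C"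
proof -
  define h where "h = H 3"
  define E where "E = h + (K * (h + h + h) + H0)"
  have "dist (mu a b (mu a b c)) (mu a b c) \<le> (h + (K * (h + h + E) + H0)) + E" for a b c
  proof -
    let ?A = "{a, b, c}"
    have "card ?A \<le> 3"
      using card_length[of "[a, b, c]"] by simp
    moreover have "1 \<le> card ?A"
      by (simp add: Suc_le_eq card_gt_0_iff)
    ultimately have A: "finite ?A \<and> 1 \<le> card ?A \<and> card ?A \<le> 3"
      by simp
    obtain P :: "nat set" and m pi lam where Pm: "median_algebra P m"
      and pi: "pi ` ?A \<subseteq> P" and lam: "quasi_hom P m mu lam h" "\<forall>c\<in>?A. dist (lam (pi c)) c \<le> h"
      by (rule cm_C2E[OF C2 A, folded h_def]) (rule that)
    interpret median P m by unfold_locales fact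
    have P: "pi a \<in> P" "pi b \<in> P" "pi c \<in> P"
      using pi by auto
    have close: "dist (lam (pi a)) a \<le> h" "dist (lam (pi b)) b \<le> h" "dist (lam (pi c)) c \<le> h"
      using lam(2) by auto
    define X where "X = m (pi a) (pi b) (pi c)"
    have X: "X \<in> P" "m (pi a) (pi b) X = X"
      using P absorb by (simp_all add: X_def)
    have d: "dist (lam X) (mu a b c) \<le> E"
      unfolding X_def E_def by (intro quasi_hom_median_close[OF lam(1)] P close)
    have "dist (lam (m (pi a) (pi b) X)) (mu a b (mu a b c)) \<le> h + (K * (h + h + E) + H0)"
      by (intro quasi_hom_median_close[OF lam(1)] P close X d)
    then show ?thesis
      using d X dist_triangle[of "mu a b (mu a b c)" "mu a b c" "lam X"]
      by (simp add: dist_commute)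
  qed
  then show thesis using that by blast
qed

text \<open>Up to \<open>e\<close>, both \<open>x\<close> and \<open>y\<close> lie between
  \<open>p\<close> and \<open>q\<close>. Thinness puts \<open>y\<close> near the interval from
  \<open>x\<close> to a corner \<open>c\<close>, one of \<open>p\<close> and \<open>q\<close>; so
  \<open>y\<close> is near \<open>mu c x y\<close>, which is near \<open>c\<close> because
  \<open>c\<close> lies coarsely between \<open>x\<close> and \<open>y\<close>.\<close>

lemma thin_square:
  assumes thin: "\<And>a b x. x \<in> cm_interval mu a b \<Longrightarrow>
      cm_interval mu a b \<subseteq> nbhd l (cm_interval mu a x) \<union> nbhd l (cm_interval mu x b)"
    and C: "\<And>a b c. dist (mu a b (mu a b c)) (mu a b c) \<le> C"
    and sq: "dist x (mu p x q) \<le> e" "dist y (mu p y q) \<le> e"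
      "dist p (mu p x y) \<le> e" "dist q (mu q x y) \<le> e"
  defines "E \<equiv> e + l + C + (K * (0 + e + (l + e)) + H0) + e"
  shows "dist y p \<le> E \<or> dist y q \<le> E"
proof -
  define X where "X = mu p x q"
  define Y where "Y = mu p y q"
  have near: "dist y c \<le> E"
    if c: "dist c (mu c x y) \<le> e" and s: "dist Y (mu c X z) \<le> l" for c z
  proof -
    define s where "s = mu c X z"
    have ys: "dist y s \<le> l + e"
      using s sq(2) dist_triangle[of y s Y] by (simp add: s_def Y_def)
    have "dist (mu c X s) s \<le> C"
      using C by (simp add: s_def)
    moreover have "dist (mu c x y) (mu c X s) \<le> K * (0 + e + (l + e)) + H0"
      using ys sq(1) by (intro mu_close) (simp_all add: X_def)
    moreover have "dist y c \<le> dist y s + dist (mu c X s) s + dist (mu c x y) (mu c X s)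
        + dist c (mu c x y)"
      using dist_triangle[of y c s] dist_triangle[of s c "mu c X s"]
        dist_triangle[of "mu c X s" c "mu c x y"]
      by (simp add: dist_commute)
    ultimately show ?thesis
      using ys c unfolding E_def by linarith
  qed
  have "X \<in> cm_interval mu p q" "Y \<in> cm_interval mu p q"
    by (auto simp: X_def Y_def cm_interval_def)
  then have "Y \<in> nbhd l (cm_interval mu p X) \<union> nbhd l (cm_interval mu X q)"
    using thin by blast
  then obtain z where "dist Y (mu p z X) \<le> l \<or> dist Y (mu X z q) \<le> l"
    unfolding nbhd_def cm_interval_def by blast
  then have "dist Y (mu p X z) \<le> l \<or> dist Y (mu q X z) \<le> l"
    using mu_swap by metis
  then show ?thesis
    using near sq by blast
qed

lemma crossing_edge_short:
  assumes thin: "\<And>a b x. x \<in> cm_interval mu a b \<Longrightarrow>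
      cm_interval mu a b \<subseteq> nbhd l (cm_interval mu a x) \<union> nbhd l (cm_interval mu x b)"
    and C: "\<And>a b c. dist (mu a b (mu a b c)) (mu a b c) \<le> C"
    and Pm: "median_algebra P m" and lam: "quasi_hom P m mu lam h"
    and e1: "edge P m u1 v1" and e2: "edge P m u2 v2"
    and cross: "crossing P (side P m u1 v1) (side P m u2 v2)"
  defines "E \<equiv> h + l + C + (K * (0 + h + (l + h)) + H0) + h"
  shows "dist (lam u1) (lam v1) \<le> h + (K * (0 + 0 + E) + H0) + h \<or>
    dist (lam u2) (lam v2) \<le> h + (K * (0 + 0 + E) + H0) + h"
proof -
  interpret median P m by unfold_locales fact
  let ?S = "side P m u1 v1" and ?T = "side P m u2 v2"
  have half: "halfspace P m ?S" "halfspace P m ?T"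
    using halfspace_side e1 e2 by blast+
  note iff = halfspace_median_iff[OF half(1)] halfspace_median_iff[OF half(2)]
  \<comment> \<open>One point is taken from each quadrant. The points \<open>x\<close> and
    \<open>y\<close> of the interval from \<open>a\<close> to \<open>b\<close> stay in the quadrants
    of \<open>x'\<close> and \<open>y'\<close>, so the first wall separates \<open>y\<close> from
    \<open>q\<close> and the second separates \<open>p\<close> from \<open>y\<close>.\<close>
  obtain a b x' y' where P: "a \<in> P" "b \<in> P" "x' \<in> P" "y' \<in> P"
    and S: "a \<notin> ?S" "b \<in> ?S" "x' \<in> ?S" "y' \<notin> ?S"
    and T: "a \<notin> ?T" "b \<in> ?T" "x' \<notin> ?T" "y' \<in> ?T"
    using cross unfolding crossing_def by metis
  define x where "x = m a b x'"
  define y where "y = m a b y'"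
  have xy: "x \<in> P" "y \<in> P"
    using P by (simp_all add: x_def y_def)
  define p where "p = m a x y"
  define q where "q = m b x y"
  have pq: "p \<in> P" "q \<in> P"
    using P xy by (simp_all add: p_def q_def)
  have xS: "x \<in> ?S" "x \<notin> ?T" and yS: "y \<notin> ?S" "y \<in> ?T"
    using P S T by (simp_all add: x_def y_def iff)
  have pS: "p \<notin> ?T" and qS: "q \<in> ?S"
    using P xy S T xS yS by (simp_all add: p_def q_def iff)
  have "m a b x = x" "m a b y = y"
    using absorb P by (simp_all add: x_def y_def)
  then have sq: "m p x y = p" "m q x y = q" "m p x q = x" "m p y q = y"
    using square[OF P(1,2) xy] by (simp_all add: p_def q_def)
  have "dist (lam y) (lam p) \<le> E \<or> dist (lam y) (lam q) \<le> E"
    unfolding E_def using quasi_homD[OF lam] pq xy sq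
    by (intro thin_square[OF thin C, of "lam x"]) metis+
  \<comment> \<open>The projection to the edge sends \<open>s\<close> to \<open>u\<close> and
    \<open>t\<close> to \<open>v\<close>; its coarse counterpart is Lipschitz up to an additive
    constant by (C1).\<close>
  moreover have short: "dist (lam u) (lam v) \<le> h + (K * (0 + 0 + E) + H0) + h"
    if e: "edge P m u v" and P: "s \<in> P" "t \<in> P" and st: "s \<notin> side P m u v" "t \<in> side P m u v"
      and d: "dist (lam s) (lam t) \<le> E" for u v s t
  proof -
    have uv: "u \<in> P" "v \<in> P" "m u v s = u" "m u v t = v"
      using e P st unfolding edge_def side_def by auto
    have "dist (lam u) (mu (lam u) (lam v) (lam s)) \<le> h"
      "dist (lam v) (mu (lam u) (lam v) (lam t)) \<le> h"
      using quasi_homD[OF lam] uv P by metis+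
    moreover have "dist (mu (lam u) (lam v) (lam s)) (mu (lam u) (lam v) (lam t))
        \<le> K * (0 + 0 + E) + H0"
      using d by (intro mu_close) simp_all
    ultimately show ?thesis
      using dist_triangle[of "lam u" "lam v" "mu (lam u) (lam v) (lam s)"]
        dist_triangle[of "mu (lam u) (lam v) (lam s)" "lam v" "mu (lam u) (lam v) (lam t)"]
      by (simp add: dist_commute)
  qed
  ultimately show ?thesis
    using short[OF e1 xy(2) pq(2) yS(1) qS] short[OF e2 pq(1) xy(2) pS yS(2)]
    by (auto simp: dist_commute)
qed

lemma rank_one_if_thin:
  assumes thin: "\<And>a b x. x \<in> cm_interval mu a b \<Longrightarrow>
      cm_interval mu a b \<subseteq> nbhd l (cm_interval mu a x) \<union> nbhd l (cm_interval mu x b)"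
    and C2: "cm_C2 mu H (\<lambda>_ _. True)"
  shows "cm_rank_le mu 1"
proof -
  obtain C where C: "\<And>a b c. dist (mu a b (mu a b c)) (mu a b c) \<le> C"
    using absorb_coarse[OF C2] by blast
  \<comment> \<open>This is the bound of \<open>crossing_edge_short\<close>, made non-negative to
    serve as a factor. In \<open>H'\<close>, passing to a representative crosses at most
    \<open>2 ^ p\<close> halfspaces, and \<open>H p\<close> is the original error.\<close>
  define L where "L h = max 0
    (h + (K * (0 + 0 + (h + l + C + (K * (0 + h + (l + h)) + H0) + h)) + H0) + h)" for h
  define H' where "H' p = L (H p) * 2 ^ p + H p" for p
  have "cm_C2 mu H' (\<lambda>P m. median_rank_le P m 1)"
    unfolding cm_C2_iff
  proof (intro allI impI)
    fix p and A :: "'a set"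
    assume A: "finite A \<and> 1 \<le> card A \<and> card A \<le> p"
    obtain P0 :: "nat set" and m pi lam where P0: "finite P0" "median_algebra P0 m" "pi ` A \<subseteq> P0"
      and lam0: "quasi_hom P0 m mu lam (H p)" and pi: "\<forall>a\<in>A. dist (lam (pi a)) a \<le> H p"
      by (rule cm_C2E[OF C2 A]) (rule that)
    obtain P where PP0: "P \<subseteq> P0" and Pm: "median_algebra P m" and gen: "generated P m (pi ` A)"
      using exists_generated_subalgebra[OF P0(2,3)] by blast
    have finP: "finite P" using P0(1) PP0 finite_subset by blast
    have lam: "quasi_hom P m mu lam (H p)"
      using lam0 PP0 unfolding quasi_hom_def by blast
    interpret median P m by unfold_locales fact
    define long where "long u v \<longleftrightarrow> edge P m u v \<and> dist (lam u) (lam v) > L (H p)" for u v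
    define W where "W = {side P m u v | u v. long u v}"
    have half: "halfspace P m S" if "S \<in> W" for S
      using that halfspace_side unfolding W_def long_def by blast
    have nocross: "\<not> crossing P S T" if ST: "S \<in> W" "T \<in> W" for S T
    proof
      assume "crossing P S T"
      moreover obtain u1 v1 u2 v2 where "S = side P m u1 v1" "T = side P m u2 v2"
        and uv: "long u1 v1" "long u2 v2"
        using ST unfolding W_def by blast
      ultimately show False
        using crossing_edge_short[OF thin C Pm lam, of u1 v1 u2 v2] unfolding long_def L_def by auto
    qed
    obtain \<sigma> where \<sigma>P: "\<And>x. x \<in> P \<Longrightarrow> \<sigma> x \<in> P"
      and \<sigma>: "\<And>x S. \<lbrakk>x \<in> P; S \<in> W\<rbrakk> \<Longrightarrow> \<sigma> x \<in> S \<longleftrightarrow> x \<in> S"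
      and alg: "median_algebra (\<sigma> ` P) (\<lambda>x y z. \<sigma> (m x y z))"
      and rank: "median_rank_le (\<sigma> ` P) (\<lambda>x y z. \<sigma> (m x y z)) 1"
      using collapse_to_noncrossing[OF Pm half nocross] by blast
    have move: "dist (lam (\<sigma> x)) (lam x) \<le> L (H p) * 2 ^ p" if x: "x \<in> P" for x
    proof -
      let ?sep = "{S. halfspace P m S \<and> \<sigma> x \<notin> S \<and> x \<in> S}"
      have "dist (lam (\<sigma> x)) (lam x) \<le> L (H p) * card ?sep"
      proof (rule dist_le_card_separating[OF Pm finP \<sigma>P[OF x] x])
        fix u v assume uv: "edge P m u v" "\<sigma> x \<notin> side P m u v" "x \<in> side P m u v"
        \<comment> \<open>A point and its representative lie in the same members of
          \<open>W\<close>, so no long edge separates them.\<close>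
        then have "\<not> long u v"
          using \<sigma>[OF x] unfolding W_def by blast
        then show "dist (lam u) (lam v) \<le> L (H p)"
          using uv unfolding long_def by simp
      qed (simp add: L_def)
      also have "real (card ?sep) \<le> 2 ^ p"
      proof -
        note halfspaces = card_halfspaces_le[OF Pm gen]
        have "card ?sep \<le> card {S. halfspace P m S}"
          using A halfspaces by (intro card_mono) auto
        also have "\<dots> \<le> 2 ^ card A"
          using A halfspaces by blast
        also have "\<dots> \<le> 2 ^ p"
          using A by (simp add: power_increasing)
        finally have "card ?sep \<le> 2 ^ p" .
        then show ?thesis
          by (metis of_nat_le_iff of_nat_numeral of_nat_power)
      qed
      then have "L (H p) * card ?sep \<le> L (H p) * 2 ^ p"
        by (intro mult_left_mono) (simp_all add: L_def)
      finally show ?thesis .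
    qed
    have piP: "pi a \<in> P" if "a \<in> A" for a
      using gen that unfolding generated_def by blast
    have "dist (lam (\<sigma> (m x y z))) (mu (lam x) (lam y) (lam z)) \<le> H' p"
      if "x \<in> P" "y \<in> P" "z \<in> P" for x y z
      using move[of "m x y z"] quasi_homD[OF lam that] that
        dist_triangle[of "lam (\<sigma> (m x y z))" "mu (lam x) (lam y) (lam z)" "lam (m x y z)"]
      by (simp add: H'_def)
    \<comment> \<open>Representatives are points of \<open>P\<close> and keep their images under
      \<open>lam\<close>; only the value of the median is moved.\<close>
    then have "quasi_hom (\<sigma> ` P) (\<lambda>x y z. \<sigma> (m x y z)) mu lam (H' p)"
      using \<sigma>P unfolding quasi_hom_def by blast
    moreover have "dist (lam ((\<sigma> \<circ> pi) a)) a \<le> H' p" if "a \<in> A" for a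
      using move[OF piP[OF that]] pi that
        dist_triangle[of "lam (\<sigma> (pi a))" a "lam (pi a)"]
      by (fastforce simp: H'_def)
    moreover have "(\<sigma> \<circ> pi) ` A \<subseteq> \<sigma> ` P"
      using piP by auto
    ultimately show "\<exists>(P :: nat set) m pi lam. finite P \<and> median_algebra P m \<and> median_rank_le P m 1 \<and>
        pi ` A \<subseteq> P \<and> quasi_hom P m mu lam (H' p) \<and> (\<forall>a\<in>A. dist (lam (pi a)) a \<le> H' p)"
      using finP alg rank
      by (intro exI[of _ "\<sigma> ` P"] exI[of _ "\<lambda>x y z. \<sigma> (m x y z)"] exI[of _ "\<sigma> \<circ> pi"] exI[of _ lam])
        simp
  qed
  then show ?thesis
    using C1 unfolding cm_rank_le_def by blast
qed

end

lemma lipschitz_median_abs: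
  assumes "cm_M2 mu" "cm_C1 mu K H0"
  shows "lipschitz_median mu \<bar>K\<bar> H0"
proof
  show "cm_C1 mu \<bar>K\<bar> H0"
    unfolding cm_C1_def
  proof (intro allI)
    fix a b c a' b' c' :: 'a
    have "dist (mu a b c) (mu a' b' c') \<le> K * (dist a a' + dist b b' + dist c c') + H0"
      using assms(2) unfolding cm_C1_def by blast
    also have "\<dots> \<le> \<bar>K\<bar> * (dist a a' + dist b b' + dist c c') + H0"
      by (intro add_right_mono mult_right_mono) auto
    finally show "dist (mu a b c) (mu a' b' c')
      \<le> \<bar>K\<bar> * (dist a a' + dist b b' + dist c c') + H0" .
  qed
qed (use assms in auto)

theorem theorem4p4:
  fixes mu :: "'a::metric_space \<Rightarrow> 'a \<Rightarrow> 'a \<Rightarrow> 'a"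
  assumes "coarse_median_space mu"
  shows "cm_rank_le mu 1 \<longleftrightarrow>
    (\<exists>l::real. \<forall>a b x. x \<in> cm_interval mu a b \<longrightarrow>
        cm_interval mu a b \<subseteq> nbhd l (cm_interval mu a x) \<union> nbhd l (cm_interval mu x b))"
proof
  have M2: "cm_M2 mu"
    using assms unfolding coarse_median_space_def by blast
  {
    assume "cm_rank_le mu 1"
    then obtain K H0 H where "cm_C1 mu K H0" and C2: "cm_C2 mu H (\<lambda>P m. median_rank_le P m 1)"
      unfolding cm_rank_le_def by blast
    then interpret lipschitz_median mu "\<bar>K\<bar>" H0
      using M2 lipschitz_median_abs by blast
    show "\<exists>l::real. \<forall>a b x. x \<in> cm_interval mu a b \<longrightarrow>
        cm_interval mu a b \<subseteq> nbhd l (cm_interval mu a x) \<union> nbhd l (cm_interval mu x b)"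
      using thin_if_rank_one[OF C2] by metis
  next
    assume "\<exists>l::real. \<forall>a b x. x \<in> cm_interval mu a b \<longrightarrow>
        cm_interval mu a b \<subseteq> nbhd l (cm_interval mu a x) \<union> nbhd l (cm_interval mu x b)"
    then obtain l where thin: "\<And>a b x. x \<in> cm_interval mu a b \<Longrightarrow>
        cm_interval mu a b \<subseteq> nbhd l (cm_interval mu a x) \<union> nbhd l (cm_interval mu x b)"
      by blast
    obtain K H0 H where "cm_C1 mu K H0" and C2: "cm_C2 mu H (\<lambda>_ _. True)"
      using assms unfolding coarse_median_space_def by blast
    then interpret lipschitz_median mu "\<bar>K\<bar>" H0
      using M2 lipschitz_median_abs by blast
    show "cm_rank_le mu 1"
      using rank_one_if_thin[OF thin C2] by blast
  }
qed

end
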